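(* (Weighted Expander Mixing Lemma) Let $(X,w)$ be a weighted graph which is also a $[\mu,\lambda]$-expander ($-1\leq\mu\leq\lambda\leq1$). Let $A,B\subseteq X(0)$ and put $\alpha=w(A)$, $\beta=w(B)$. Then: (i) $\left|\frac12 w(E_{\mathrm{ord}}(A,B))-\alpha\beta\right|\leq\max\{|\lambda|,|\mu|\}\sqrt{\alpha\beta(1-\alpha)(1-\beta)}$. (ii) $\mu\alpha(1-\alpha)\leq w(E(A))-\alpha^2\leq\lambda\alpha(1-\alpha)$.
   Context: A graph is a finite simplicial complex $X$ of dimension at most $1$ (a nonempty finite family of finite sets closed under taking subsets, so $\emptyset\in X$). $X(i)$ denotes the set of faces of dimension $i$ (cardinality $i+1$); $X(0)$ is the set of vertices and $X(1)$ the set of edges. A weighted graph is a pair $(X,w)$ where $X$ is a graph that is pure of dimension $1$ (every face is contained in an edge) and $w:X\to[0,\infty)$ satisfies $\sum_{e\in X(1)}w(e)=1$, $w(v)=\frac12\sum_{e\in X(1),\,e\supseteq v}w(e)$ for all $v\in X(0)$, $w(\emptyset)=1$, and $w(v)>0$ for all $v\in X(0)$. For a set $A$ of faces, $w(A)=\sum_{a\in A}w(a)$. $E_{\mathrm{ord}}(A,B)$ is the set of ordered pairs $(u,v)$ with $u\in A$, $v\in B$ and $\{u,v\}$ an edge; the weight of an ordered edge is that of the underlying edge, and the weight of a set of ordered edges is the sum of the weights of its members. $E(A)$ is the set of (unordered) edges with both vertices in $A$. Spectral expansion: on functions $f:X(0)\to\mathbb{R}$ with inner product $\langle f,g\rangle=\sum_{v}w(v)f(v)g(v)$,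 the weighted adjacency operator is $(\mathcal{A}f)(v)=\sum_{e\in X(1),\,e\supseteq v}\frac{w(e)}{2w(v)}f(e-v)$, where $e-v$ is the other vertex of $e$. It is self-adjoint and preserves $C^0_\circ(X,\mathbb{R})=\{f:\sum_v w(v)f(v)=0\}$. $(X,w)$ is a $[\mu,\lambda]$-expander if all eigenvalues of $\mathcal{A}$ on $C^0_\circ(X,\mathbb{R})$ lie in $[\mu,\lambda]$. *)

theory Defs
  imports "HOL-Analysis.Analysis"
begin

definition is_graph :: "'a set set \<Rightarrow> bool" where
  "is_graph X \<longleftrightarrow> finite X \<and> X \<noteq> {} \<and> (\<forall>s\<in>X. finite s) \<and>
     (\<forall>s\<in>X. \<forall>t. t \<subseteq> s \<longrightarrow> t \<in> X) \<and> (\<forall>s\<in>X. card s \<le> 2)"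

definition faces :: "'a set set \<Rightarrow> nat \<Rightarrow> 'a set set" where
  "faces X i = {s \<in> X. card s = i + 1}"

text \<open>Following the usual convention, a vertex \<open>v\<close> is identified with the 0-face \<open>{v}\<close>:
  sets of vertices and functions on vertices are indexed by the elements \<open>v\<close>, whereas the
  weight function is defined on faces, so that the weight of the vertex \<open>v\<close> is \<open>w {v}\<close>.\<close>

definition verts :: "'a set set \<Rightarrow> 'a set" where
  "verts X = {v. {v} \<in> faces X 0}"

definition is_weighted_graph :: "'a set set \<Rightarrow> ('a set \<Rightarrow> real) \<Rightarrow> bool" where
  "is_weighted_graph X w \<longleftrightarrow>
     is_graph X \<and>
     (\<forall>s\<in>X. \<exists>e\<in>faces X 1. s \<subseteq> e) \<and>
     (\<forall>s\<in>X. 0 \<le> w s) \<and>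
     (\<Sum>e\<in>faces X 1. w e) = 1 \<and>
     (\<forall>v\<in>verts X. w {v} = 1/2 * (\<Sum>e\<in>{e \<in> faces X 1. v \<in> e}. w e)) \<and>
     w {} = 1 \<and>
     (\<forall>v\<in>verts X. 0 < w {v})"

definition wt :: "('a set \<Rightarrow> real) \<Rightarrow> 'a set set \<Rightarrow> real" where
  "wt w F = (\<Sum>s\<in>F. w s)"

definition wt_verts :: "('a set \<Rightarrow> real) \<Rightarrow> 'a set \<Rightarrow> real" where
  "wt_verts w A = wt w ((\<lambda>v. {v}) ` A)"

definition E_ord :: "'a set set \<Rightarrow> 'a set \<Rightarrow> 'a set \<Rightarrow> ('a \<times> 'a) set" where
  "E_ord X A B = {(u, v). u \<in> A \<and> v \<in> B \<and> {u, v} \<in> faces X 1}"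

definition wt_ord :: "('a set \<Rightarrow> real) \<Rightarrow> ('a \<times> 'a) set \<Rightarrow> real" where
  "wt_ord w P = (\<Sum>(u, v)\<in>P. w {u, v})"

definition E_in :: "'a set set \<Rightarrow> 'a set \<Rightarrow> 'a set set" where
  "E_in X A = {e \<in> faces X 1. e \<subseteq> A}"

text \<open>Real functions on the vertex set are represented by total functions that vanish off
  \<open>verts X\<close>. The adjacency operator preserves this representation: off \<open>verts X\<close> the sum
  below is empty.\<close>

definition C0 :: "'a set set \<Rightarrow> ('a \<Rightarrow> real) set" where
  "C0 X = {f. \<forall>v. v \<notin> verts X \<longrightarrow> f v = 0}"

definition C0_circ :: "'a set set \<Rightarrow> ('a set \<Rightarrow> real) \<Rightarrow> ('a \<Rightarrow> real) set" where
  "C0_circ X w = {f \<in> C0 X. (\<Sum>v\<in>verts X. w {v} * f v) = 0}"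

definition adj_op :: "'a set set \<Rightarrow> ('a set \<Rightarrow> real) \<Rightarrow> ('a \<Rightarrow> real) \<Rightarrow> 'a \<Rightarrow> real" where
  "adj_op X w f = (\<lambda>v. \<Sum>e\<in>{e \<in> faces X 1. v \<in> e}. w e / (2 * w {v}) * f (the_elem (e - {v})))"

text \<open>Only real eigenvalues need to be considered: the operator is self-adjoint with respect
  to the inner product \<open>\<Sum>v. w {v} * f v * g v\<close>, which is positive definite on functions on
  the vertices because vertices have positive weight.\<close>

definition eigenvalue_on :: "('a \<Rightarrow> real) set \<Rightarrow> (('a \<Rightarrow> real) \<Rightarrow> 'a \<Rightarrow> real) \<Rightarrow> real \<Rightarrow> bool" where
  "eigenvalue_on V T c \<longleftrightarrow> (\<exists>f\<in>V. f \<noteq> (\<lambda>_. 0) \<and> T f = (\<lambda>v. c * f v))"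

definition is_expander :: "'a set set \<Rightarrow> ('a set \<Rightarrow> real) \<Rightarrow> real \<Rightarrow> real \<Rightarrow> bool" where
  "is_expander X w \<mu> l \<longleftrightarrow> (\<forall>c. eigenvalue_on (C0_circ X w) (adj_op X w) c \<longrightarrow> c \<in> {\<mu>..l})"

end

theory Submission
  imports Defs
begin

text \<open>The maximum of the Rayleigh quotient of a self-adjoint operator on an invariant subspace is
  attained, by compactness of the unit sphere, and it is an eigenvalue, because the first variation
  vanishes at a maximiser. So the expander property bounds the quadratic form of the adjacency
  operator on functions of mean zero from both sides, and by polarisation it bounds the bilinear
  form. The theorem follows by inserting the centred indicators of \<open>A\<close> and \<open>B\<close>, whose squared norms
  are \<open>\<alpha> (1 - \<alpha>)\<close> and \<open>\<beta> (1 - \<beta>)\<close>.\<close>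

section \<open>Rayleigh quotients of symmetric kernels\<close>

text \<open>The common ratio \<open>r\<close> of row sums and weights is left free so that the results apply to both
  \<open>M\<close> and \<open>- M\<close>.\<close>

locale symmetric_kernel =
  fixes V :: "'a set" and p :: "'a \<Rightarrow> real" and M :: "'a \<Rightarrow> 'a \<Rightarrow> real" and r :: real
  assumes fin: "finite V"
    and p_pos: "v \<in> V \<Longrightarrow> 0 < p v"
    and M_sym: "M u v = M v u"
    and row_sum: "v \<in> V \<Longrightarrow> (\<Sum>u\<in>V. M v u) = r * p v"
begin

section \<open>Inner product, form and operator of a kernel\<close>

definition ip :: "('a \<Rightarrow> real) \<Rightarrow> ('a \<Rightarrow> real) \<Rightarrow> real" where
  "ip f g = (\<Sum>v\<in>V. p v * f v * g v)"

text \<open>This is the bilinear form of \<open>kernel_op\<close> with respect to \<open>ip\<close>,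
  written without division by \<open>p\<close>, so that its symmetry is just that of
  \<open>M\<close>.\<close>

definition form :: "('a \<Rightarrow> real) \<Rightarrow> ('a \<Rightarrow> real) \<Rightarrow> real" where
  "form f g = (\<Sum>u\<in>V. \<Sum>v\<in>V. M u v * f u * g v)"

text \<open>The value 0 off \<open>V\<close> keeps the result in the representation by functions
  vanishing off \<open>V\<close>, so eigenvalue equations hold as equations of total
  functions.\<close>

definition kernel_op :: "('a \<Rightarrow> real) \<Rightarrow> 'a \<Rightarrow> real" where
  "kernel_op f = (\<lambda>v. if v \<in> V then (\<Sum>u\<in>V. M v u * f u) / p v else 0)"

definition centred :: "('a \<Rightarrow> real) set" where
  "centred = {f. (\<forall>v. v \<notin> V \<longrightarrow> f v = 0) \<and> (\<Sum>v\<in>V. p v * f v) = 0}"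

lemma ip_nonneg: "0 \<le> ip f f"
  unfolding ip_def by (intro sum_nonneg) (simp add: p_pos less_imp_le mult.assoc)

lemma ip_eq_0_iff: "ip f f = 0 \<longleftrightarrow> (\<forall>v\<in>V. f v = 0)"
proof -
  have "ip f f = 0 \<longleftrightarrow> (\<forall>v\<in>V. p v * f v * f v = 0)"
    unfolding ip_def by (intro sum_nonneg_eq_0_iff fin) (simp add: p_pos less_imp_le mult.assoc)
  also have "\<dots> \<longleftrightarrow> (\<forall>v\<in>V. f v = 0)"
    using p_pos by force
  finally show ?thesis .
qed

lemma form_commute: "form f g = form g f"
  unfolding form_def by (subst sum.swap) (simp add: M_sym mult_ac)

text \<open>With two free scalars the expansion covers normalisation (\<open>b = 0\<close>),
  variation (\<open>a = 1\<close>) and polarisation alike.\<close>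

lemma ip_combine:
  "ip (\<lambda>v. a * f v + b * g v) (\<lambda>v. a * f v + b * g v)
    = a\<^sup>2 * ip f f + 2 * a * b * ip f g + b\<^sup>2 * ip g g"
  unfolding ip_def sum_distrib_left sum.distrib[symmetric]
  by (intro sum.cong) (auto simp: algebra_simps power2_eq_square)

lemma form_combine:
  "form (\<lambda>v. a * f v + b * g v) (\<lambda>v. a * f v + b * g v)
    = a\<^sup>2 * form f f + 2 * a * b * form f g + b\<^sup>2 * form g g"
proof -
  have "form (\<lambda>v. a * f v + b * g v) (\<lambda>v. a * f v + b * g v)
    = a\<^sup>2 * form f f + a * b * form f g + a * b * form g f + b\<^sup>2 * form g g"
    unfolding form_def sum_distrib_left sum.distrib[symmetric]
    by (intro sum.cong) (auto simp: algebra_simps power2_eq_square)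
  then show ?thesis
    by (simp add: form_commute[of g f])
qed

lemma centred_combine:
  assumes "f \<in> centred" "g \<in> centred"
  shows "(\<lambda>v. a * f v + b * g v) \<in> centred"
proof -
  have "(\<Sum>v\<in>V. p v * (a * f v + b * g v))
      = a * (\<Sum>v\<in>V. p v * f v) + b * (\<Sum>v\<in>V. p v * g v)"
    unfolding sum_distrib_left sum.distrib[symmetric]
    by (intro sum.cong) (auto simp: algebra_simps)
  with assms show ?thesis
    by (simp add: centred_def)
qed

lemma ip_kernel_op: "ip (kernel_op f) g = form f g"
proof -
  have "ip (kernel_op f) g = (\<Sum>v\<in>V. \<Sum>u\<in>V. M v u * g v * f u)"
    unfolding ip_def
  proof (intro sum.cong refl)
    fix v assume "v \<in> V"
    then have "p v * kernel_op f v = (\<Sum>u\<in>V. M v u * f u)"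
      using p_pos[of v] by (simp add: kernel_op_def)
    then show "p v * kernel_op f v * g v = (\<Sum>u\<in>V. M v u * g v * f u)"
      by (simp add: sum_distrib_left sum_distrib_right mult_ac)
  qed
  also have "\<dots> = form g f"
    by (simp add: form_def)
  finally show ?thesis
    by (simp add: form_commute)
qed

text \<open>By \<open>row_sum\<close> the constant function on \<open>V\<close> is an eigenvector
  with value \<open>r\<close>. A self-adjoint operator preserves the orthogonal complement of an
  eigenvector, and for the constants this complement is \<open>centred\<close>.\<close>

lemma kernel_op_centred:
  assumes "f \<in> centred"
  shows "kernel_op f \<in> centred"
proof -
  have "(\<Sum>v\<in>V. p v * kernel_op f v) = form f (\<lambda>_. 1)"
    by (simp add: ip_kernel_op[symmetric] ip_def)
  also have "\<dots> = (\<Sum>u\<in>V. f u * (\<Sum>v\<in>V. M u v))"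
    by (simp add: form_def sum_distrib_left mult_ac)
  also have "\<dots> = r * (\<Sum>u\<in>V. p u * f u)"
    by (simp add: row_sum sum_distrib_left mult_ac)
  finally show ?thesis
    using assms by (simp add: centred_def kernel_op_def)
qed

section \<open>Compactness and the largest eigenvalue\<close>

text \<open>The type may be infinite, so compactness comes from Tychonoff: the sphere is a closed
  subset of a product of intervals, with factor \<open>{0}\<close> off \<open>V\<close>.\<close>

lemma compact_unit_sphere: "compact {f \<in> centred. ip f f = 1}"
proof -
  \<comment> \<open>On the sphere the square of \<open>f v\<close> is at most
    \<open>1 / p v\<close>. Adding 1 gives a number at least 1, whose square dominates
    \<open>1 / p v\<close>; this avoids a square root.\<close>
  define I :: "'a \<Rightarrow> real set"
    where "I v = (if v \<in> V then {- (1 + 1 / p v)..1 + 1 / p v} else {0})" for v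
  have "compactin (product_topology (\<lambda>_. euclidean) UNIV) (PiE UNIV I)"
    by (subst compactin_PiE) (auto simp: I_def)
  then have box: "compact (PiE UNIV I)"
    by (simp add: euclidean_product_topology)
  have coord: "continuous_on UNIV (\<lambda>f :: 'a \<Rightarrow> real. f v)" for v
    by simp
  have "closed (\<Inter>v\<in>- V. {f :: 'a \<Rightarrow> real. f v = 0})"
    by (intro closed_INT ballI closed_Collect_eq coord continuous_on_const)
  moreover have "closed {f :: 'a \<Rightarrow> real. (\<Sum>v\<in>V. p v * f v) = 0}"
    by (intro closed_Collect_eq continuous_intros coord)
  moreover have "closed {f. ip f f = 1}"
    unfolding ip_def by (intro closed_Collect_eq continuous_intros coord)
  ultimately have "closed ((\<Inter>v\<in>- V. {f. f v = 0}) \<inter> {f. (\<Sum>v\<in>V. p v * f v) = 0}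
      \<inter> {f. ip f f = 1})"
    by (intro closed_Int)
  also have "\<dots> = {f \<in> centred. ip f f = 1}"
    by (auto simp: centred_def)
  finally have closed: "closed {f \<in> centred. ip f f = 1}" .
  have "{f \<in> centred. ip f f = 1} \<subseteq> PiE UNIV I"
  proof clarify
    fix f assume f: "f \<in> centred" "ip f f = 1"
    have "f v \<in> I v" for v
    proof (cases "v \<in> V")
      case True
      have "p v * f v * f v \<le> ip f f"
        unfolding ip_def using True
        by (intro member_le_sum fin) (auto simp: p_pos less_imp_le mult.assoc)
      then have "(f v)\<^sup>2 \<le> 1 / p v"
        using f(2) p_pos[OF True] by (simp add: field_simps power2_eq_square)
      also have "\<dots> \<le> (1 + 1 / p v)\<^sup>2"
        using p_pos[OF True] by (intro order_trans[OF _ self_le_power]) auto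
      finally have "\<bar>f v\<bar> \<le> 1 + 1 / p v"
        using p_pos[OF True] by (simp add: abs_le_square_iff[symmetric])
      then show ?thesis
        using True by (auto simp: I_def)
    next
      case False
      then show ?thesis
        using f by (simp add: I_def centred_def)
    qed
    then show "f \<in> PiE UNIV I"
      by auto
  qed
  then show ?thesis
    using compact_Int_closed[OF box closed] by (simp add: Int_absorb1)
qed

text \<open>The eigenvalue is the maximum of the form on the unit sphere. The function
  \<open>f0\<close> ensures that the sphere is nonempty.\<close>

lemma exists_maximal_eigenvalue:
  assumes "f0 \<in> centred" "ip f0 f0 \<noteq> 0"
  obtains c where "eigenvalue_on centred kernel_op c"
    and "\<And>f. f \<in> centred \<Longrightarrow> form f f \<le> c * ip f f"
proof -
  let ?S = "{f \<in> centred. ip f f = 1}"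
  \<comment> \<open>The zero summand brings the normalised function into the shape of the
    combination lemmas.\<close>
  define nrm where "nrm f = (\<lambda>v. 1 / sqrt (ip f f) * f v + 0 * f v)" for f
  have nrm: "nrm f \<in> ?S" "form f f = ip f f * form (nrm f) (nrm f)"
    if "f \<in> centred" "ip f f \<noteq> 0" for f
    using that ip_nonneg[of f]
    using centred_combine[OF that(1) that(1), of "1 / sqrt (ip f f)" 0]
    unfolding nrm_def ip_combine form_combine mem_Collect_eq
    by (auto simp: power_divide)
  have coord: "continuous_on ?S (\<lambda>f. f v)" for v
    by (rule continuous_on_subset[of UNIV]) auto
  have "continuous_on ?S (\<lambda>f. form f f)"
    unfolding form_def by (intro continuous_intros coord)
  moreover have "?S \<noteq> {}"
    using nrm(1)[OF assms] by blast
  ultimately obtain f where f: "f \<in> centred" "ip f f = 1"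
    and max: "\<And>g. g \<in> ?S \<Longrightarrow> form g g \<le> form f f"
    using continuous_attains_sup[OF compact_unit_sphere] by blast
  define c where "c = form f f"
  have le: "form g g \<le> c * ip g g" if g: "g \<in> centred" for g
  proof (cases "ip g g = 0")
    case True
    then have "form g g = 0"
      by (simp add: form_def ip_eq_0_iff)
    then show ?thesis
      using True by simp
  next
    case False
    then show ?thesis
      using nrm[OF g False] max[OF nrm(1)[OF g False]] ip_nonneg[of g]
      by (simp add: c_def mult.commute mult_left_mono)
  qed
  \<comment> \<open>The residual of the eigenvalue equation at the maximiser serves as the direction
    of variation; the aim is to show that its norm is 0.\<close>
  define g where "g = (\<lambda>v. 1 * kernel_op f v + (- c) * f v)"
  have g: "g \<in> centred"
    unfolding g_def by (intro centred_combine kernel_op_centred f)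
  have first_variation: "form f g - c * ip f g = ip g g"
  proof -
    have "ip g g = ip (kernel_op f) g - c * ip f g"
      unfolding ip_def sum_distrib_left sum_subtractf[symmetric]
      by (intro sum.cong) (auto simp: g_def algebra_simps)
    then show ?thesis
      by (simp add: ip_kernel_op)
  qed
  \<comment> \<open>The defect \<open>c * ip h h - form h h\<close> is nonnegative for centred
    \<open>h\<close> and is 0 at \<open>h = f\<close>. Expanding it at \<open>f + t g\<close> bounds
    the linear term in \<open>t\<close> by the quadratic one.\<close>
  have var: "2 * t * ip g g \<le> t\<^sup>2 * (c * ip g g - form g g)" for t
  proof -
    have "form (\<lambda>v. 1 * f v + t * g v) (\<lambda>v. 1 * f v + t * g v)
        \<le> c * ip (\<lambda>v. 1 * f v + t * g v) (\<lambda>v. 1 * f v + t * g v)"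
      by (intro le centred_combine f g)
    then show ?thesis
      unfolding ip_combine form_combine first_variation[symmetric]
      using f(2) by (simp add: c_def algebra_simps)
  qed
  have "ip g g = 0"
  proof (rule ccontr)
    assume "ip g g \<noteq> 0"
    then have pos: "0 < ip g g"
      using ip_nonneg[of g] by simp
    define d where "d = c * ip g g - form g g"
    have d: "0 \<le> d"
      using le[OF g] by (simp add: d_def)
    \<comment> \<open>A step this small gives \<open>t * d \<le> ip g g\<close>, against the bound
      \<open>2 * ip g g \<le> t * d\<close>. The summand 1 covers \<open>d = 0\<close>.\<close>
    define t where "t = ip g g / (1 + d)"
    have t: "0 < t"
      using pos d by (simp add: t_def)
    have "t * (2 * ip g g) \<le> t * (t * d)"
      using var[of t] by (simp add: d_def power2_eq_square mult_ac)
    then have "2 * ip g g \<le> t * d"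
      using t by simp
    also have "\<dots> \<le> ip g g"
      using pos d by (simp add: t_def field_simps)
    finally show False
      using pos by simp
  qed
  then have "kernel_op f v = c * f v" for v
    using g f by (cases "v \<in> V") (auto simp: ip_eq_0_iff g_def centred_def kernel_op_def)
  moreover have "f \<noteq> (\<lambda>_. 0)"
    using f(2) by (auto simp: ip_def)
  ultimately have "eigenvalue_on centred kernel_op c"
    using f(1) by (auto simp: eigenvalue_on_def)
  then show thesis
    using le that by blast
qed

section \<open>Spectral bounds on the form\<close>

text \<open>If \<open>f\<close> has nonzero norm, it serves itself as the witness that the largest
  eigenvalue exists; otherwise it vanishes on \<open>V\<close> and both sides are 0.\<close>

lemma form_le:
  assumes "\<And>c. eigenvalue_on centred kernel_op c \<Longrightarrow> c \<le> l" and "f \<in> centred"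
  shows "form f f \<le> l * ip f f"
proof (cases "ip f f = 0")
  case True
  then show ?thesis
    by (simp add: form_def ip_eq_0_iff[THEN iffD1])
next
  case False
  then obtain c where "eigenvalue_on centred kernel_op c" "form f f \<le> c * ip f f"
    using exists_maximal_eigenvalue[OF assms(2)] assms(2) by metis
  then show ?thesis
    using assms(1)[of c] ip_nonneg[of f] by (meson mult_right_mono order_trans)
qed

text \<open>Negating the kernel negates the eigenvalues and the form, so the upper bound applies to
  \<open>- M\<close>. Neither \<open>ip\<close> nor \<open>centred\<close> involves the kernel, so
  both carry over.\<close>

lemma form_ge:
  assumes "\<And>c. eigenvalue_on centred kernel_op c \<Longrightarrow> m \<le> c" and "f \<in> centred"
  shows "m * ip f f \<le> form f f"
proof -
  interpret neg: symmetric_kernel V p "\<lambda>u v. - M u v" "- r"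
    by unfold_locales (simp_all add: fin p_pos M_sym row_sum sum_negf)
  have op: "neg.kernel_op g = (\<lambda>v. - kernel_op g v)" for g
    by (auto simp: neg.kernel_op_def kernel_op_def sum_negf)
  have "c \<le> - m" if "eigenvalue_on centred neg.kernel_op c" for c
  proof -
    obtain f where f: "f \<in> centred" "f \<noteq> (\<lambda>_. 0)" "neg.kernel_op f = (\<lambda>v. c * f v)"
      using \<open>eigenvalue_on centred neg.kernel_op c\<close> by (auto simp: eigenvalue_on_def)
    have "kernel_op f v = - c * f v" for v
      using fun_cong[OF f(3), of v] by (simp add: op)
    then have "eigenvalue_on centred kernel_op (- c)"
      using f(1,2) by (auto simp: eigenvalue_on_def)
    then show ?thesis
      using assms(1)[of "- c"] by simp
  qed
  then have "neg.form f f \<le> - m * ip f f"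
    using assms(2) by (rule neg.form_le)
  then show ?thesis
    by (simp add: neg.form_def form_def sum_negf)
qed

text \<open>Polarisation: the form at \<open>b f + a g\<close> minus the form at
  \<open>b f - a g\<close> is \<open>4 * a * b * form f g\<close>. With \<open>a\<close>,
  \<open>b\<close> the norms of \<open>f\<close>, \<open>g\<close>, the squared norms of these two
  functions sum to \<open>4 * (a * b)\<^sup>2\<close>, which yields the sharp constant.\<close>

lemma abs_form_le:
  assumes bound: "\<And>f. f \<in> centred \<Longrightarrow> \<bar>form f f\<bar> \<le> m * ip f f"
    and f: "f \<in> centred" and g: "g \<in> centred"
  shows "\<bar>form f g\<bar> \<le> m * sqrt (ip f f * ip g g)"
proof (cases "ip f f = 0 \<or> ip g g = 0")
  case True
  then show ?thesis
    by (auto simp: form_def ip_eq_0_iff[THEN iffD1])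
next
  case False
  define a b where "a = sqrt (ip f f)" and "b = sqrt (ip g g)"
  have pos: "0 < a" "0 < b"
    using False ip_nonneg[of f] ip_nonneg[of g] by (auto simp: a_def b_def)
  have sq: "ip f f = a\<^sup>2" "ip g g = b\<^sup>2"
    using ip_nonneg by (auto simp: a_def b_def)
  have "\<bar>form (\<lambda>v. b * f v + a * g v) (\<lambda>v. b * f v + a * g v)\<bar>
      \<le> m * ip (\<lambda>v. b * f v + a * g v) (\<lambda>v. b * f v + a * g v)"
    "\<bar>form (\<lambda>v. b * f v + (- a) * g v) (\<lambda>v. b * f v + (- a) * g v)\<bar>
      \<le> m * ip (\<lambda>v. b * f v + (- a) * g v) (\<lambda>v. b * f v + (- a) * g v)"
    by (intro bound centred_combine f g)+
  then have "\<bar>4 * (a * b * form f g)\<bar> \<le> 4 * (a * b * (m * (a * b)))"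
    unfolding ip_combine form_combine sq by (simp add: algebra_simps power2_eq_square)
  then have "(a * b) * \<bar>form f g\<bar> \<le> (a * b) * (m * (a * b))"
    using pos by (simp add: abs_mult)
  then have "\<bar>form f g\<bar> \<le> m * (a * b)"
    using pos by (simp only: mult_le_cancel_left_pos mult_pos_pos)
  then show ?thesis
    by (simp add: a_def b_def real_sqrt_mult)
qed

end

section \<open>The kernel of a weighted graph\<close>

text \<open>The factor 1/2 makes the row sums equal to the vertex weights. The diagonal is 0 because
  \<open>{v, v}\<close> is not an edge.\<close>

definition edge_kernel :: "'a set set \<Rightarrow> ('a set \<Rightarrow> real) \<Rightarrow> 'a \<Rightarrow> 'a \<Rightarrow> real" where
  "edge_kernel X w u v = (if {u, v} \<in> faces X 1 then w {u, v} / 2 else 0)"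

lemma wt_verts_eq: "wt_verts w A = (\<Sum>v\<in>A. w {v})"
  unfolding wt_verts_def wt_def by (subst sum.reindex) auto

lemma finite_verts:
  assumes "is_graph X"
  shows "finite (verts X)"
proof -
  have "finite ((\<lambda>v. {v}) -` X)"
    using assms by (intro finite_vimageI) (auto simp: is_graph_def)
  then show ?thesis
    by (rule rev_finite_subset) (auto simp: verts_def faces_def)
qed

lemma edge_verts:
  assumes "is_graph X" "{u, v} \<in> faces X 1"
  shows "u \<in> verts X" "v \<in> verts X" "u \<noteq> v"
  using assms by (auto simp: is_graph_def faces_def verts_def)

lemma edgeE:
  assumes "e \<in> faces X 1" "v \<in> e"
  obtains u where "e = {v, u}" "u \<noteq> v"
proof -
  have "card e = 2"
    using assms by (simp add: faces_def)
  then obtain x y where "e = {x, y}" "x \<noteq> y"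
    by (meson card_2_iff)
  then show thesis
    using assms(2) that[of x] that[of y] by blast
qed

text \<open>An edge at \<open>v\<close> is determined by its other endpoint. Letting
  \<open>h\<close> depend on both edge and endpoint serves the row sums as well as the adjacency
  operator.\<close>

lemma sum_edges_at:
  assumes "is_graph X"
  shows "(\<Sum>e\<in>{e \<in> faces X 1. v \<in> e}. h e (the_elem (e - {v})))
       = (\<Sum>u\<in>{u \<in> verts X. {v, u} \<in> faces X 1}. h {v, u} u)"
proof (rule sum.reindex_bij_betw[symmetric, THEN trans])
  show "bij_betw (\<lambda>u. {v, u}) {u \<in> verts X. {v, u} \<in> faces X 1} {e \<in> faces X 1. v \<in> e}"
    unfolding bij_betw_def
  proof
    show "inj_on (\<lambda>u. {v, u}) {u \<in> verts X. {v, u} \<in> faces X 1}"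
      by (rule inj_onI) (metis doubleton_eq_iff)
    show "(\<lambda>u. {v, u}) ` {u \<in> verts X. {v, u} \<in> faces X 1} = {e \<in> faces X 1. v \<in> e}"
    proof
      show "{e \<in> faces X 1. v \<in> e} \<subseteq> (\<lambda>u. {v, u}) ` {u \<in> verts X. {v, u} \<in> faces X 1}"
        using edge_verts(2)[OF assms] by (clarify, metis (mono_tags, lifting) edgeE imageI mem_Collect_eq)
    qed auto
  qed
  have "the_elem ({v, u} - {v}) = u" if "{v, u} \<in> faces X 1" for u
  proof -
    have "{v, u} - {v} = {u}"
      using edge_verts(3)[OF assms that] by auto
    then show ?thesis
      by simp
  qed
  then show "(\<Sum>u\<in>{u \<in> verts X. {v, u} \<in> faces X 1}. h {v, u} (the_elem ({v, u} - {v})))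
      = (\<Sum>u\<in>{u \<in> verts X. {v, u} \<in> faces X 1}. h {v, u} u)"
    by (intro sum.cong) auto
qed

lemma sum_edge_kernel:
  assumes "finite A"
  shows "(\<Sum>u\<in>A. edge_kernel X w v u * f u) = (\<Sum>u\<in>{u \<in> A. {v, u} \<in> faces X 1}. w {v, u} / 2 * f u)"
  using assms by (intro sum.mono_neutral_cong_right) (auto simp: edge_kernel_def)

lemma symmetric_kernel_graph:
  assumes "is_weighted_graph X w"
  shows "symmetric_kernel (verts X) (\<lambda>v. w {v}) (edge_kernel X w) 1"
proof
  have graph: "is_graph X"
    using assms by (simp add: is_weighted_graph_def)
  then show fin: "finite (verts X)"
    by (rule finite_verts)
  show "0 < w {v}" if "v \<in> verts X" for v
    using that assms by (simp add: is_weighted_graph_def)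
  show "edge_kernel X w u v = edge_kernel X w v u" for u v
    by (simp add: edge_kernel_def insert_commute)
  show "(\<Sum>u\<in>verts X. edge_kernel X w v u) = 1 * w {v}" if "v \<in> verts X" for v
  proof -
    have "(\<Sum>u\<in>verts X. edge_kernel X w v u) = 1/2 * (\<Sum>e\<in>{e \<in> faces X 1. v \<in> e}. w e)"
      using sum_edge_kernel[OF fin, of X w v "\<lambda>_. 1"] sum_edges_at[OF graph, of "\<lambda>e _. w e" v]
      by (simp add: sum_divide_distrib)
    moreover have "w {v} = 1/2 * (\<Sum>e\<in>{e \<in> faces X 1. v \<in> e}. w e)"
      using that assms by (simp add: is_weighted_graph_def)
    ultimately show ?thesis
      by simp
  qed
qed

section \<open>Edge weights as kernel sums\<close>

lemma wt_ord_E_ord: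
  assumes "finite A" "finite B"
  shows "1/2 * wt_ord w (E_ord X A B) = (\<Sum>u\<in>A. \<Sum>v\<in>B. edge_kernel X w u v)"
proof -
  have "(\<Sum>u\<in>A. \<Sum>v\<in>B. edge_kernel X w u v) = (\<Sum>(u, v)\<in>A \<times> B. edge_kernel X w u v)"
    by (rule sum.cartesian_product)
  also have "\<dots> = (\<Sum>(u, v)\<in>E_ord X A B. w {u, v} / 2)"
    using assms by (intro sum.mono_neutral_cong_right) (auto simp: E_ord_def edge_kernel_def split: if_splits)
  finally show ?thesis
    by (simp add: wt_ord_def sum_divide_distrib split_def)
qed

text \<open>Forgetting the order maps exactly two ordered pairs to each edge, so the sum is grouped
  by the fibres of this map. This makes part (ii) the case \<open>B = A\<close> of the computation
  for part (i).\<close>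

lemma wt_E_in:
  assumes "is_graph X" "finite A"
  shows "wt w (E_in X A) = 1/2 * wt_ord w (E_ord X A A)"
proof -
  have fin: "finite (E_ord X A A)"
    by (rule finite_subset[of _ "A \<times> A"]) (auto simp: E_ord_def assms(2))
  have img: "(\<lambda>(u, v). {u, v}) ` E_ord X A A = E_in X A"
  proof
    show "(\<lambda>(u, v). {u, v}) ` E_ord X A A \<subseteq> E_in X A"
      by (auto simp: E_ord_def E_in_def)
    show "E_in X A \<subseteq> (\<lambda>(u, v). {u, v}) ` E_ord X A A"
    proof
      fix e assume e: "e \<in> E_in X A"
      then obtain x where "x \<in> e"
        by (force simp: E_in_def faces_def)
      then obtain u where "e = {x, u}"
        using e edgeE[of e X x] unfolding E_in_def by blast
      then show "e \<in> (\<lambda>(u, v). {u, v}) ` E_ord X A A"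
        using e by (intro image_eqI[of _ _ "(x, u)"]) (auto simp: E_ord_def E_in_def)
    qed
  qed
  have fibre: "(\<Sum>z\<in>{z \<in> E_ord X A A. case_prod (\<lambda>u v. {u, v}) z = e}. case_prod (\<lambda>u v. w {u, v}) z)
      = 2 * w e"
    if e: "e \<in> E_in X A" for e
  proof -
    obtain x where "x \<in> e"
      using e by (force simp: E_in_def faces_def)
    then obtain y where y: "e = {x, y}" "y \<noteq> x"
      using e edgeE[of e X x] unfolding E_in_def by blast
    have "{z \<in> E_ord X A A. case_prod (\<lambda>u v. {u, v}) z = e} = {(x, y), (y, x)}"
    proof
      show "{(x, y), (y, x)} \<subseteq> {z \<in> E_ord X A A. case_prod (\<lambda>u v. {u, v}) z = e}"
        using e y(1) insert_commute[of x y "{}"] by (simp add: E_ord_def E_in_def)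
      show "{z \<in> E_ord X A A. case_prod (\<lambda>u v. {u, v}) z = e} \<subseteq> {(x, y), (y, x)}"
        unfolding y(1) by (clarsimp simp only: doubleton_eq_iff)
    qed
    moreover have "w {y, x} = w {x, y}"
      by (rule arg_cong[of _ _ w]) blast
    ultimately show ?thesis
      using y by simp
  qed
  have "wt_ord w (E_ord X A A)
      = (\<Sum>e\<in>E_in X A. \<Sum>z\<in>{z \<in> E_ord X A A. case_prod (\<lambda>u v. {u, v}) z = e}.
          case_prod (\<lambda>u v. w {u, v}) z)"
    unfolding wt_ord_def img[symmetric] by (rule sum.image_gen[OF fin])
  also have "\<dots> = (\<Sum>e\<in>E_in X A. 2 * w e)"
    by (rule sum.cong[OF refl fibre])
  finally show ?thesis
    by (simp add: wt_def sum_distrib_left[symmetric])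
qed

text \<open>Handshake argument: the sum of all kernel entries is the total vertex weight by rows,
  and the total edge weight when grouped by edges.\<close>

lemma sum_verts_weight:
  assumes "is_weighted_graph X w"
  shows "(\<Sum>v\<in>verts X. w {v}) = 1"
proof -
  have graph: "is_graph X" and total: "(\<Sum>e\<in>faces X 1. w e) = 1"
    using assms by (auto simp: is_weighted_graph_def)
  interpret symmetric_kernel "verts X" "\<lambda>v. w {v}" "edge_kernel X w" 1
    by (rule symmetric_kernel_graph[OF assms])
  have "e \<subseteq> verts X" if "e \<in> faces X 1" for e
    using that graph by (auto simp: is_graph_def faces_def verts_def)
  then have "E_in X (verts X) = faces X 1"
    by (auto simp: E_in_def)
  then have "1 = wt w (E_in X (verts X))"
    using total by (simp add: wt_def)
  also have "\<dots> = (\<Sum>u\<in>verts X. \<Sum>v\<in>verts X. edge_kernel X w u v)"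
    by (simp only: wt_E_in[OF graph fin] wt_ord_E_ord[OF fin fin])
  finally show ?thesis
    by (simp add: row_sum)
qed

section \<open>The mixing lemma\<close>

theorem theorem3p2:
  fixes X :: "'a set set" and w :: "'a set \<Rightarrow> real"
    and \<mu> l \<alpha> \<beta> :: real and A B :: "'a set"
  assumes "is_weighted_graph X w"
    and "-1 \<le> \<mu>" and "\<mu> \<le> l" and "l \<le> 1"
    and "is_expander X w \<mu> l"
    and "A \<subseteq> verts X" and "B \<subseteq> verts X"
    and "\<alpha> = wt_verts w A" and "\<beta> = wt_verts w B"
  shows "\<bar>1/2 * wt_ord w (E_ord X A B) - \<alpha> * \<beta>\<bar>
           \<le> max \<bar>l\<bar> \<bar>\<mu>\<bar> * sqrt (\<alpha> * \<beta> * (1 - \<alpha>) * (1 - \<beta>))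
       \<and> \<mu> * \<alpha> * (1 - \<alpha>) \<le> wt w (E_in X A) - \<alpha>\<^sup>2
       \<and> wt w (E_in X A) - \<alpha>\<^sup>2 \<le> l * \<alpha> * (1 - \<alpha>)"
proof -
  have graph: "is_graph X"
    using assms(1) by (simp add: is_weighted_graph_def)
  interpret symmetric_kernel "verts X" "\<lambda>v. w {v}" "edge_kernel X w" 1
    by (rule symmetric_kernel_graph[OF assms(1)])
  note total = sum_verts_weight[OF assms(1)]
  have centred: "C0_circ X w = centred"
    by (auto simp: C0_circ_def C0_def centred_def)
  \<comment> \<open>At a vertex, dividing the kernel entry \<open>w e / 2\<close> by
    \<open>w {v}\<close> gives the coefficient of the adjacency operator. Off the vertex set no edge
    contains \<open>v\<close>, so both sides are 0.\<close>
  have op: "adj_op X w = kernel_op"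
  proof (intro ext)
    fix f v
    show "adj_op X w f v = kernel_op f v"
    proof (cases "v \<in> verts X")
      case True
      then show ?thesis
        unfolding adj_op_def kernel_op_def sum_edge_kernel[OF fin]
        using sum_edges_at[OF graph, of "\<lambda>e u. w e / (2 * w {v}) * f u" v]
        by (simp add: sum_divide_distrib)
    next
      case False
      then have "{e \<in> faces X 1. v \<in> e} = {}"
        using edge_verts(1)[OF graph] edgeE[of _ X v] by blast
      then show ?thesis
        using False by (simp only: adj_op_def kernel_op_def) simp
    qed
  qed
  have eig: "\<mu> \<le> c \<and> c \<le> l" if "eigenvalue_on centred kernel_op c" for c
    using that assms(5) by (simp add: is_expander_def centred op)
  have upper: "form f f \<le> l * ip f f" if "f \<in> centred" for f
    using form_le that eig by blast
  have lower: "\<mu> * ip f f \<le> form f f" if "f \<in> centred" for f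
    using form_ge that eig by blast
  have abs_bound: "\<bar>form f f\<bar> \<le> max \<bar>l\<bar> \<bar>\<mu>\<bar> * ip f f" if "f \<in> centred" for f
  proof -
    have "l * ip f f \<le> max \<bar>l\<bar> \<bar>\<mu>\<bar> * ip f f" "- max \<bar>l\<bar> \<bar>\<mu>\<bar> * ip f f \<le> \<mu> * ip f f"
      by (intro mult_right_mono ip_nonneg; linarith)+
    then show ?thesis
      using upper[OF that] lower[OF that] by linarith
  qed
  \<comment> \<open>The total vertex weight is 1, so \<open>wt_verts w S\<close> is the mean of the
    indicator of \<open>S\<close>, and \<open>ind S\<close> is its orthogonal projection to the
    functions of mean zero.\<close>
  define ind where "ind S v = (if v \<in> verts X then indicator S v - wt_verts w S else 0)"
    for S :: "'a set" and v
  have sum_ind: "(\<Sum>v\<in>verts X. h v * indicator S v) = (\<Sum>v\<in>S. h v)"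
    if "S \<subseteq> verts X" for S and h :: "'a \<Rightarrow> real"
    using that fin by (simp add: sum.If_cases indicator_def if_distrib Int_absorb1 cong: if_cong)
  have ind_centred: "ind S \<in> centred" if "S \<subseteq> verts X" for S
  proof -
    have "(\<Sum>v\<in>verts X. w {v} * ind S v)
        = (\<Sum>v\<in>verts X. w {v} * indicator S v) - (\<Sum>v\<in>verts X. w {v}) * wt_verts w S"
      by (simp add: ind_def algebra_simps sum_subtractf sum_distrib_left)
    then have "(\<Sum>v\<in>verts X. w {v} * ind S v) = 0"
      by (simp add: sum_ind[OF that] total wt_verts_eq)
    then show ?thesis
      by (simp add: centred_def ind_def)
  qed
  have ip_ind: "ip (ind S) (ind S) = wt_verts w S * (1 - wt_verts w S)" if S: "S \<subseteq> verts X" for S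
  proof -
    \<comment> \<open>Since \<open>ind S\<close> is orthogonal to constants, its second copy may be
      replaced by the plain indicator of \<open>S\<close>.\<close>
    have "ip (ind S) (ind S) = (\<Sum>v\<in>verts X. w {v} * ind S v * indicator S v)
        - wt_verts w S * (\<Sum>v\<in>verts X. w {v} * ind S v)"
      unfolding ip_def sum_distrib_left sum_subtractf[symmetric]
      by (intro sum.cong) (auto simp: ind_def algebra_simps)
    also have "\<dots> = (\<Sum>v\<in>S. w {v} * ind S v)"
      using ind_centred[OF S] by (simp add: sum_ind[OF S] centred_def)
    also have "\<dots> = (\<Sum>v\<in>S. w {v} * (1 - wt_verts w S))"
      using S by (intro sum.cong) (auto simp: ind_def)
    finally show ?thesis
      by (simp add: wt_verts_eq sum_distrib_right)
  qed
  have row: "(\<Sum>v\<in>verts X. edge_kernel X w u v * ind S v)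
      = (\<Sum>v\<in>S. edge_kernel X w u v) - w {u} * wt_verts w S"
    if "u \<in> verts X" "S \<subseteq> verts X" for u S
  proof -
    have "(\<Sum>v\<in>verts X. edge_kernel X w u v * ind S v)
        = (\<Sum>v\<in>verts X. edge_kernel X w u v * indicator S v)
          - (\<Sum>v\<in>verts X. edge_kernel X w u v) * wt_verts w S"
      by (simp add: ind_def algebra_simps sum_subtractf sum_distrib_left)
    then show ?thesis
      by (simp add: sum_ind[OF that(2)] row_sum[OF that(1)])
  qed
  have form_ind: "form (ind S) (ind T) = 1/2 * wt_ord w (E_ord X S T) - wt_verts w S * wt_verts w T"
    if S: "S \<subseteq> verts X" and T: "T \<subseteq> verts X" for S T
  proof -
    \<comment> \<open>Centring \<open>ind T\<close> contributes a multiple of \<open>w {u}\<close>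
      in row \<open>u\<close>, which vanishes against \<open>ind S\<close>. After swapping the sums,
      centring \<open>ind S\<close> contributes the product of the two weights.\<close>
    have "form (ind S) (ind T)
        = (\<Sum>u\<in>verts X. ind S u * (\<Sum>v\<in>verts X. edge_kernel X w u v * ind T v))"
      by (simp add: form_def sum_distrib_left mult_ac)
    also have "\<dots> = (\<Sum>u\<in>verts X. ind S u * ((\<Sum>v\<in>T. edge_kernel X w u v) - w {u} * wt_verts w T))"
      by (intro sum.cong refl) (simp only: row[OF _ T])
    also have "\<dots> = (\<Sum>u\<in>verts X. ind S u * (\<Sum>v\<in>T. edge_kernel X w u v))
        - wt_verts w T * (\<Sum>u\<in>verts X. w {u} * ind S u)"
      by (simp add: algebra_simps sum_subtractf sum_distrib_left)
    also have "\<dots> = (\<Sum>u\<in>verts X. \<Sum>v\<in>T. ind S u * edge_kernel X w u v)"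
      using ind_centred[OF S] by (simp add: centred_def sum_distrib_left)
    also have "\<dots> = (\<Sum>v\<in>T. \<Sum>u\<in>verts X. edge_kernel X w v u * ind S u)"
      by (subst sum.swap) (simp add: M_sym mult.commute)
    also have "\<dots> = (\<Sum>v\<in>T. (\<Sum>u\<in>S. edge_kernel X w v u) - w {v} * wt_verts w S)"
      using S T by (intro sum.cong refl row) auto
    also have "\<dots> = (\<Sum>u\<in>S. \<Sum>v\<in>T. edge_kernel X w u v) - wt_verts w S * wt_verts w T"
      unfolding sum_subtractf sum_distrib_right[symmetric] wt_verts_eq[symmetric]
      by (subst sum.swap) (simp add: M_sym mult.commute)
    finally show ?thesis
      using S T fin by (simp only: wt_ord_E_ord finite_subset)
  qed
  have "\<bar>form (ind A) (ind B)\<bar> \<le> max \<bar>l\<bar> \<bar>\<mu>\<bar> * sqrt (ip (ind A) (ind A) * ip (ind B) (ind B))"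
    by (intro abs_form_le abs_bound ind_centred assms)
  \<comment> \<open>On the diagonal, half the ordered weight is the weight of the unordered edges,
    so the one-sided bounds on the form become part (ii).\<close>
  moreover have "form (ind A) (ind A) = wt w (E_in X A) - \<alpha>\<^sup>2"
    using wt_E_in[OF graph finite_subset[OF assms(6) fin], of w] assms(8)
    by (simp add: form_ind[OF assms(6,6)] power2_eq_square)
  ultimately show ?thesis
    using upper[OF ind_centred[OF assms(6)]] lower[OF ind_centred[OF assms(6)]]
    unfolding form_ind[OF assms(6,7)] ip_ind[OF assms(6)] ip_ind[OF assms(7)] assms(8,9)[symmetric]
    by (simp add: mult_ac)
qed

end
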